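(* Assume that $\mathcal{D}$ is an inclusion-closed collection and that the mean random dynamical system $\Phi$ on $L^p(\Omega,X)$ possesses an invariant weak $\mathcal{D}$-pullback mean random attractor $\mathcal{A}\in\mathcal{D}$ which is backwards bounded. Then for every $t\in\mathbb{R}$ $$\mathcal{A}(t)=\{\phi(t):\phi\in\mathcal{D}\text{ is a backwards bounded complete trajectory}\}.$$ If, moreover, $\mathcal{D}$ contains any backwards bounded family, then for every $t\in\mathbb{R}$ $$\mathcal{A}(t)=\{\phi(t):\phi\text{ is a backwards bounded complete trajectory}\}.$$
   Context: $X$ is a Banach space, $(\Omega,\mathcal{F},P)$ a probability space, $p\in(1,\infty)$, and $L^p(\Omega,X)$ the Banach space of Bochner integrable $y:\Omega\to X$ with $\int_\Omega\|y\|_X^p\,dP<\infty$. $\mathcal{D}$ is a given collection of families $D=\{D(t)\}_{t\in\mathbb{R}}$ of non-empty bounded sets $D(t)\subset L^p(\Omega,X)$; it is inclusion-closed if $D\in\mathcal{D}$ and $\emptyset\ne B(t)\subset D(t)$ ($B(t)$ bounded) for all $t$ imply $\{B(t)\}_{t\in\mathbb{R}}\in\mathcal{D}$. A mean random dynamical system is a family of maps $\Phi(t,\tau):L^p(\Omega,X)\to L^p(\Omega,X)$, $t\ge0$, $\tau\in\mathbb{R}$, with $\Phi(0,\tau)=\mathrm{id}$ and $\Phi(t+s,\tau)=\Phi(t,s+\tau)\circ\Phi(s,\tau)$ for $t,s\ge0$. $K\in\mathcal{D}$ is $\mathcal{D}$-pullback weakly attracting if for all $\tau\in\mathbb{R}$,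 $D\in\mathcal{D}$ and any weak neighborhood $\mathcal{N}^w(K(\tau))$ of $K(\tau)$ there is $T>0$ with $\Phi(t,\tau-t)D(\tau-t)\subset\mathcal{N}^w(K(\tau))$ for all $t\ge T$. $\mathcal{A}\in\mathcal{D}$ is a weak $\mathcal{D}$-pullback mean random attractor if (1) each $\mathcal{A}(t)$ is weakly compact; (2) $\mathcal{A}$ is $\mathcal{D}$-pullback weakly attracting; (3) if $B\in\mathcal{D}$ satisfies (1) and (2), then $\mathcal{A}(t)\subset B(t)$ for all $t$. It is invariant if $\mathcal{A}(t)=\Phi(\tau,t-\tau)\mathcal{A}(t-\tau)$ for all $\tau\ge0$, $t\in\mathbb{R}$. A map $\phi:\mathbb{R}\to L^p(\Omega,X)$ is a complete trajectory if $\phi(t)=\Phi(t-s,s)\phi(s)$ for all $s<t$; it is identified with the family of singletons $\{\{\phi(t)\}\}_{t\in\mathbb{R}}$, and $\phi\in\mathcal{D}$ means that this family belongs to $\mathcal{D}$. A family $D=\{D(t)\}_{t\in\mathbb{R}}$ of non-empty bounded sets is backwards bounded if there is $t_0\in\mathbb{R}$ such that $\bigcup_{t\le t_0}D(t)$ is bounded. *)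

theory Defs
  imports "HOL-Probability.Probability"
begin

(* The library's has_bochner_integral and integrable require a second countable target type, i.e. a
   separable Banach space. The following is the same definition for arbitrary Banach spaces, with
   Borel measurability replaced by strong measurability. Demanding the limit everywhere rather than
   almost everywhere loses no class modulo a.e. equality, and makes strongly measurable functions
   Borel measurable even if the measure is not complete. *)

definition strongly_measurable :: "'a measure \<Rightarrow> ('a \<Rightarrow> 'b::banach) \<Rightarrow> bool" where
  "strongly_measurable M y \<longleftrightarrow>
     (\<exists>s. (\<forall>i. simple_function M (s i)) \<and> (\<forall>\<omega>\<in>space M. (\<lambda>i::nat. s i \<omega>) \<longlonglongrightarrow> y \<omega>))"

definition bochner_integrable :: "'a measure \<Rightarrow> ('a \<Rightarrow> 'b::banach) \<Rightarrow> bool" where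
  "bochner_integrable M y \<longleftrightarrow> strongly_measurable M y \<and>
     (\<exists>s. (\<forall>i. Bochner_Integration.simple_bochner_integrable M (s i)) \<and>
          (\<lambda>i::nat. \<integral>\<^sup>+\<omega>. ennreal (norm (y \<omega> - s i \<omega>)) \<partial>M) \<longlonglongrightarrow> 0)"

definition Lp_functions :: "'a measure \<Rightarrow> real \<Rightarrow> ('a \<Rightarrow> 'b::banach) set" where
  "Lp_functions M p =
     {y. bochner_integrable M y \<and> integrable M (\<lambda>\<omega>. norm (y \<omega>) powr p)}"

definition Lp_rel :: "'a measure \<Rightarrow> real \<Rightarrow> (('a \<Rightarrow> 'b::banach) \<times> ('a \<Rightarrow> 'b)) set" where
  "Lp_rel M p = {(y, z). y \<in> Lp_functions M p \<and> z \<in> Lp_functions M p \<and> (AE \<omega> in M. y \<omega> = z \<omega>)}"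

definition Lp_class :: "'a measure \<Rightarrow> real \<Rightarrow> ('a \<Rightarrow> 'b::banach) \<Rightarrow> ('a \<Rightarrow> 'b) set" where
  "Lp_class M p y = Lp_rel M p `` {y}"

definition Lp :: "'a measure \<Rightarrow> real \<Rightarrow> ('a \<Rightarrow> 'b::banach) set set" where
  "Lp M p = Lp_functions M p // Lp_rel M p"

definition Lp_norm :: "'a measure \<Rightarrow> real \<Rightarrow> ('a \<Rightarrow> 'b::banach) set \<Rightarrow> real" where
  "Lp_norm M p Y = (\<integral>\<omega>. norm ((SOME y. y \<in> Y) \<omega>) powr p \<partial>M) powr (1 / p)"

lemma equiv_Lp_rel:
  "equiv (Lp_functions M p :: ('a \<Rightarrow> 'b::banach) set) (Lp_rel M p)"
proof (rule equivI)
  let ?F = "Lp_functions M p :: ('a \<Rightarrow> 'b) set"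
  let ?R = "Lp_rel M p :: (('a \<Rightarrow> 'b) \<times> ('a \<Rightarrow> 'b)) set"
  show "refl_on ?F ?R" and "?R \<subseteq> ?F \<times> ?F"
    by (auto simp: refl_on_def Lp_rel_def)
  show "sym ?R"
  proof (rule symI)
    fix y z :: "'a \<Rightarrow> 'b"
    assume "(y, z) \<in> Lp_rel M p"
    then have mem: "y \<in> Lp_functions M p" "z \<in> Lp_functions M p" and "AE \<omega> in M. y \<omega> = z \<omega>"
      by (simp_all add: Lp_rel_def)
    from this(3) have "AE \<omega> in M. z \<omega> = y \<omega>"
      by (rule eventually_mono) simp
    with mem show "(z, y) \<in> Lp_rel M p"
      by (simp add: Lp_rel_def)
  qed
  show "trans ?R"
  proof (rule transI)
    fix x y z :: "'a \<Rightarrow> 'b"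
    assume "(x, y) \<in> Lp_rel M p" "(y, z) \<in> Lp_rel M p"
    then have mem: "x \<in> Lp_functions M p" "z \<in> Lp_functions M p"
        and "AE \<omega> in M. x \<omega> = y \<omega>" "AE \<omega> in M. y \<omega> = z \<omega>"
      by (simp_all add: Lp_rel_def)
    from this(3,4) have "AE \<omega> in M. x \<omega> = z \<omega>"
      by (rule eventually_elim2) simp
    with mem show "(x, z) \<in> Lp_rel M p"
      by (simp add: Lp_rel_def)
  qed
qed

lemma strongly_measurable_imp_borel_measurable:
  assumes "strongly_measurable M y"
  shows "y \<in> borel_measurable M"
proof -
  obtain s where s: "\<And>i::nat. simple_function M (s i)"
    and lim: "\<And>\<omega>. \<omega> \<in> space M \<Longrightarrow> (\<lambda>i. s i \<omega>) \<longlonglongrightarrow> y \<omega>"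
    using assms by (auto simp: strongly_measurable_def)
  show ?thesis
    by (rule borel_measurable_LIMSEQ_metric[OF borel_measurable_simple_function[OF s] lim])
qed

lemma strongly_measurable_linear_combination:
  assumes "strongly_measurable M y" "strongly_measurable M z"
  shows "strongly_measurable M (\<lambda>\<omega>. a *\<^sub>R y \<omega> + b *\<^sub>R z \<omega>)"
proof -
  obtain s t where "\<forall>i::nat. simple_function M (s i)" "\<forall>\<omega>\<in>space M. (\<lambda>i. s i \<omega>) \<longlonglongrightarrow> y \<omega>"
      "\<forall>i::nat. simple_function M (t i)" "\<forall>\<omega>\<in>space M. (\<lambda>i. t i \<omega>) \<longlonglongrightarrow> z \<omega>"
    using assms by (auto simp: strongly_measurable_def)
  then show ?thesis
    unfolding strongly_measurable_def
    by (intro exI[of _ "\<lambda>i \<omega>. a *\<^sub>R s i \<omega> + b *\<^sub>R t i \<omega>"])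
       (auto intro!: tendsto_intros simple_function_compose2[where h = "\<lambda>u v. a *\<^sub>R u + b *\<^sub>R v"])
qed

lemma bochner_integrable_linear_combination:
  assumes y: "bochner_integrable M y" and z: "bochner_integrable M z"
  shows "bochner_integrable M (\<lambda>\<omega>. a *\<^sub>R y \<omega> + b *\<^sub>R z \<omega>)"
proof -
  obtain s t where s: "\<And>i::nat. Bochner_Integration.simple_bochner_integrable M (s i)"
      and sl: "(\<lambda>i. \<integral>\<^sup>+\<omega>. ennreal (norm (y \<omega> - s i \<omega>)) \<partial>M) \<longlonglongrightarrow> 0"
      and t: "\<And>i::nat. Bochner_Integration.simple_bochner_integrable M (t i)"
      and tl: "(\<lambda>i. \<integral>\<^sup>+\<omega>. ennreal (norm (z \<omega> - t i \<omega>)) \<partial>M) \<longlonglongrightarrow> 0"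
    using assms by (auto simp: bochner_integrable_def)
  have sm: "strongly_measurable M y" "strongly_measurable M z"
    using y z by (auto simp: bochner_integrable_def)
  have simp_s: "simple_function M (s i)" "simple_function M (t i)" for i
    using s t by (auto elim: simple_bochner_integrable.cases)
  have diff_meas: "(\<lambda>\<omega>. norm (u \<omega> - v \<omega>)) \<in> borel_measurable M"
    if "strongly_measurable M u" "simple_function M v" for u v :: "'a \<Rightarrow> 'b"
  proof -
    have "strongly_measurable M v"
      unfolding strongly_measurable_def using that(2) by (intro exI[of _ "\<lambda>_. v"]) auto
    then have "strongly_measurable M (\<lambda>\<omega>. 1 *\<^sub>R u \<omega> + (-1) *\<^sub>R v \<omega>)"
      by (rule strongly_measurable_linear_combination[OF that(1)])
    from strongly_measurable_imp_borel_measurable[OF this] have "(\<lambda>\<omega>. u \<omega> - v \<omega>) \<in> borel_measurable M"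
      by simp
    then show ?thesis
      by (rule measurable_compose[OF _ borel_measurable_norm])
  qed
  note [measurable] = diff_meas[OF sm(1) simp_s(1)] diff_meas[OF sm(2) simp_s(2)]
  let ?w = "\<lambda>i \<omega>. a *\<^sub>R s i \<omega> + b *\<^sub>R t i \<omega>"
  let ?g = "\<lambda>i. ennreal \<bar>a\<bar> * (\<integral>\<^sup>+\<omega>. ennreal (norm (y \<omega> - s i \<omega>)) \<partial>M)
              + ennreal \<bar>b\<bar> * (\<integral>\<^sup>+\<omega>. ennreal (norm (z \<omega> - t i \<omega>)) \<partial>M)"
  have "(\<integral>\<^sup>+\<omega>. ennreal (norm (a *\<^sub>R y \<omega> + b *\<^sub>R z \<omega> - ?w i \<omega>)) \<partial>M) \<le> ?g i" for i
  proof -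
    have "norm (a *\<^sub>R y \<omega> + b *\<^sub>R z \<omega> - ?w i \<omega>)
        \<le> \<bar>a\<bar> * norm (y \<omega> - s i \<omega>) + \<bar>b\<bar> * norm (z \<omega> - t i \<omega>)" for \<omega>
      using norm_diff_triangle_ineq[of "a *\<^sub>R y \<omega>" "b *\<^sub>R z \<omega>" "a *\<^sub>R s i \<omega>" "b *\<^sub>R t i \<omega>"]
      by (simp flip: scaleR_diff_right)
    then have "(\<integral>\<^sup>+\<omega>. ennreal (norm (a *\<^sub>R y \<omega> + b *\<^sub>R z \<omega> - ?w i \<omega>)) \<partial>M)
        \<le> (\<integral>\<^sup>+\<omega>. ennreal \<bar>a\<bar> * ennreal (norm (y \<omega> - s i \<omega>))
             + ennreal \<bar>b\<bar> * ennreal (norm (z \<omega> - t i \<omega>)) \<partial>M)"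
      by (intro nn_integral_mono) (simp flip: ennreal_mult ennreal_plus)
    also have "\<dots> = ?g i"
      by (simp add: nn_integral_add nn_integral_cmult)
    finally show ?thesis .
  qed
  moreover have "?g \<longlonglongrightarrow> 0"
    using tendsto_add[OF ennreal_tendsto_cmult[OF _ sl, of "ennreal \<bar>a\<bar>"]
        ennreal_tendsto_cmult[OF _ tl, of "ennreal \<bar>b\<bar>"]] by simp
  ultimately have "(\<lambda>i. \<integral>\<^sup>+\<omega>. ennreal (norm (a *\<^sub>R y \<omega> + b *\<^sub>R z \<omega> - ?w i \<omega>)) \<partial>M) \<longlonglongrightarrow> 0"
    by (rule tendsto_sandwich[OF always_eventually[OF allI[OF zero_le]]
          always_eventually[OF allI] tendsto_const])
  moreover have "Bochner_Integration.simple_bochner_integrable M (?w i)" for i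
    using s t by (intro simple_bochner_integrable_compose2[where p = "\<lambda>u v. a *\<^sub>R u + b *\<^sub>R v"]) auto
  ultimately show ?thesis
    using strongly_measurable_linear_combination[OF sm] unfolding bochner_integrable_def
    by (intro conjI exI[of _ ?w]) auto
qed

lemma Lp_functions_linear_combination:
  assumes "y \<in> Lp_functions M p" "z \<in> Lp_functions M p" "0 \<le> p"
  shows "(\<lambda>\<omega>. a *\<^sub>R y \<omega> + b *\<^sub>R z \<omega>) \<in> Lp_functions M p"
proof -
  let ?w = "\<lambda>\<omega>. a *\<^sub>R y \<omega> + b *\<^sub>R z \<omega>"
  have bi: "bochner_integrable M ?w"
    using assms by (intro bochner_integrable_linear_combination) (auto simp: Lp_functions_def)
  then have "?w \<in> borel_measurable M"
    by (simp add: bochner_integrable_def strongly_measurable_imp_borel_measurable)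
  from measurable_compose[OF this borel_measurable_norm]
  have meas: "(\<lambda>\<omega>. norm (?w \<omega>) powr p) \<in> borel_measurable M"
    by (rule powr_real_measurable[OF _ borel_measurable_const])
  let ?f = "\<lambda>\<omega>. (2 * \<bar>a\<bar>) powr p * norm (y \<omega>) powr p + (2 * \<bar>b\<bar>) powr p * norm (z \<omega>) powr p"
  have le: "norm (?w \<omega>) powr p \<le> ?f \<omega>" for \<omega>
  proof -
    have "norm (?w \<omega>) \<le> \<bar>a\<bar> * norm (y \<omega>) + \<bar>b\<bar> * norm (z \<omega>)"
      using norm_triangle_ineq[of "a *\<^sub>R y \<omega>" "b *\<^sub>R z \<omega>"] by simp
    also have "\<dots> \<le> max (2 * \<bar>a\<bar> * norm (y \<omega>)) (2 * \<bar>b\<bar> * norm (z \<omega>))"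
      by linarith
    finally have "norm (?w \<omega>) powr p \<le> max (2 * \<bar>a\<bar> * norm (y \<omega>)) (2 * \<bar>b\<bar> * norm (z \<omega>)) powr p"
      using assms(3) by (intro powr_mono2) auto
    also have "\<dots> \<le> (2 * \<bar>a\<bar> * norm (y \<omega>)) powr p + (2 * \<bar>b\<bar> * norm (z \<omega>)) powr p"
      by (auto simp: max_def)
    also have "\<dots> = ?f \<omega>"
      by (simp add: powr_mult)
    finally show ?thesis .
  qed
  have "integrable M ?f"
    using assms by (auto simp: Lp_functions_def)
  then have "integrable M (\<lambda>\<omega>. norm (?w \<omega>) powr p)"
  proof (rule Bochner_Integration.integrable_bound[OF _ meas], intro AE_I2)
    fix \<omega>
    show "norm (norm (?w \<omega>) powr p) \<le> norm (?f \<omega>)"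
      using le[of \<omega>] by simp
  qed
  with bi show ?thesis
    by (simp add: Lp_functions_def)
qed

lemma Lp_norm_class:
  assumes "y \<in> Lp_functions M p"
  shows "Lp_norm M p (Lp_class M p y) = (\<integral>\<omega>. norm (y \<omega>) powr p \<partial>M) powr (1 / p)"
proof -
  have "y \<in> Lp_class M p y"
    using assms by (simp add: Lp_class_def Lp_rel_def)
  then have "(SOME z. z \<in> Lp_class M p y) \<in> Lp_class M p y"
    by (rule someI[where P = "\<lambda>z. z \<in> Lp_class M p y"])
  then obtain z where z: "z = (SOME z. z \<in> Lp_class M p y)" "z \<in> Lp_functions M p"
      "AE \<omega> in M. y \<omega> = z \<omega>"
    by (auto simp: Lp_class_def Lp_rel_def)
  have "(\<integral>\<omega>. norm (z \<omega>) powr p \<partial>M) = (\<integral>\<omega>. norm (y \<omega>) powr p \<partial>M)"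
    using assms z(2,3) by (intro integral_cong_AE) (auto simp: Lp_functions_def)
  then show ?thesis
    by (simp add: Lp_norm_def flip: z(1))
qed

definition Lp_bounded :: "'a measure \<Rightarrow> real \<Rightarrow> ('a \<Rightarrow> 'b::banach) set set \<Rightarrow> bool" where
  "Lp_bounded M p B \<longleftrightarrow> B \<subseteq> Lp M p \<and> (\<exists>C. \<forall>Y\<in>B. Lp_norm M p Y \<le> C)"

(* Bounded linear functionals on the quotient space; linearity is expressed through representatives,
   whose linear combinations are again in Lp_functions by Lp_functions_linear_combination. Only the
   values on Lp M p matter. *)

definition Lp_dual :: "'a measure \<Rightarrow> real \<Rightarrow> (('a \<Rightarrow> 'b::banach) set \<Rightarrow> real) set" where
  "Lp_dual M p = {l.
     (\<forall>y\<in>Lp_functions M p. \<forall>z\<in>Lp_functions M p.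
        l (Lp_class M p (\<lambda>\<omega>. y \<omega> + z \<omega>)) = l (Lp_class M p y) + l (Lp_class M p z)) \<and>
     (\<forall>c. \<forall>y\<in>Lp_functions M p.
        l (Lp_class M p (\<lambda>\<omega>. c *\<^sub>R y \<omega>)) = c * l (Lp_class M p y)) \<and>
     (\<exists>C. \<forall>Y\<in>Lp M p. \<bar>l Y\<bar> \<le> C * Lp_norm M p Y)}"

definition weak_topology :: "'a measure \<Rightarrow> real \<Rightarrow> ('a \<Rightarrow> 'b::banach) set topology" where
  "weak_topology M p =
     topology_generated_by {{Y \<in> Lp M p. l Y \<in> U} | l U. l \<in> Lp_dual M p \<and> open (U :: real set)}"

definition weak_nbhd ::
  "'a measure \<Rightarrow> real \<Rightarrow> ('a \<Rightarrow> 'b::banach) set set \<Rightarrow> ('a \<Rightarrow> 'b) set set \<Rightarrow> bool" where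
  "weak_nbhd M p K N \<longleftrightarrow>
     N \<subseteq> Lp M p \<and> (\<exists>U. openin (weak_topology M p) U \<and> K \<subseteq> U \<and> U \<subseteq> N)"

type_synonym ('a, 'b) Lp_family = "real \<Rightarrow> ('a \<Rightarrow> 'b) set set"
type_synonym ('a, 'b) Lp_process = "real \<Rightarrow> real \<Rightarrow> ('a \<Rightarrow> 'b) set \<Rightarrow> ('a \<Rightarrow> 'b) set"

definition bounded_family :: "'a measure \<Rightarrow> real \<Rightarrow> ('a, 'b::banach) Lp_family \<Rightarrow> bool" where
  "bounded_family M p D \<longleftrightarrow> (\<forall>t. D t \<noteq> {} \<and> Lp_bounded M p (D t))"

definition inclusion_closed :: "'a measure \<Rightarrow> real \<Rightarrow> ('a, 'b::banach) Lp_family set \<Rightarrow> bool" where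
  "inclusion_closed M p \<D> \<longleftrightarrow>
     (\<forall>D\<in>\<D>. \<forall>B. bounded_family M p B \<and> (\<forall>t. B t \<subseteq> D t) \<longrightarrow> B \<in> \<D>)"

definition backwards_bounded :: "'a measure \<Rightarrow> real \<Rightarrow> ('a, 'b::banach) Lp_family \<Rightarrow> bool" where
  "backwards_bounded M p D \<longleftrightarrow>
     bounded_family M p D \<and> (\<exists>t0. Lp_bounded M p (\<Union>t\<in>{..t0}. D t))"

definition mean_RDS :: "'a measure \<Rightarrow> real \<Rightarrow> ('a, 'b::banach) Lp_process \<Rightarrow> bool" where
  "mean_RDS M p \<Phi> \<longleftrightarrow>
     (\<forall>t\<ge>0. \<forall>\<tau>. \<Phi> t \<tau> \<in> Lp M p \<rightarrow> Lp M p) \<and>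
     (\<forall>\<tau>. \<forall>Y\<in>Lp M p. \<Phi> 0 \<tau> Y = Y) \<and>
     (\<forall>t\<ge>0. \<forall>s\<ge>0. \<forall>\<tau>. \<forall>Y\<in>Lp M p. \<Phi> (t + s) \<tau> Y = \<Phi> t (s + \<tau>) (\<Phi> s \<tau> Y))"

definition pullback_weakly_attracting ::
  "'a measure \<Rightarrow> real \<Rightarrow> ('a, 'b::banach) Lp_family set \<Rightarrow> ('a, 'b) Lp_process \<Rightarrow>
   ('a, 'b) Lp_family \<Rightarrow> bool" where
  "pullback_weakly_attracting M p \<D> \<Phi> K \<longleftrightarrow> K \<in> \<D> \<and>
     (\<forall>\<tau>. \<forall>D\<in>\<D>. \<forall>N. weak_nbhd M p (K \<tau>) N \<longrightarrow>
        (\<exists>T>0. \<forall>t\<ge>T. \<Phi> t (\<tau> - t) ` D (\<tau> - t) \<subseteq> N))"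

definition weak_pullback_mean_random_attractor ::
  "'a measure \<Rightarrow> real \<Rightarrow> ('a, 'b::banach) Lp_family set \<Rightarrow> ('a, 'b) Lp_process \<Rightarrow>
   ('a, 'b) Lp_family \<Rightarrow> bool" where
  "weak_pullback_mean_random_attractor M p \<D> \<Phi> A \<longleftrightarrow> A \<in> \<D> \<and>
     (\<forall>t. compactin (weak_topology M p) (A t)) \<and>
     pullback_weakly_attracting M p \<D> \<Phi> A \<and>
     (\<forall>B\<in>\<D>. (\<forall>t. compactin (weak_topology M p) (B t)) \<and>
              pullback_weakly_attracting M p \<D> \<Phi> B \<longrightarrow> (\<forall>t. A t \<subseteq> B t))"

definition invariant_family :: "('a, 'b) Lp_process \<Rightarrow> ('a, 'b) Lp_family \<Rightarrow> bool" where
  "invariant_family \<Phi> A \<longleftrightarrow> (\<forall>\<tau>\<ge>0. \<forall>t. A t = \<Phi> \<tau> (t - \<tau>) ` A (t - \<tau>))"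

definition complete_trajectory ::
  "'a measure \<Rightarrow> real \<Rightarrow> ('a, 'b::banach) Lp_process \<Rightarrow> (real \<Rightarrow> ('a \<Rightarrow> 'b) set) \<Rightarrow> bool" where
  "complete_trajectory M p \<Phi> \<phi> \<longleftrightarrow>
     (\<forall>t. \<phi> t \<in> Lp M p) \<and> (\<forall>s t. s < t \<longrightarrow> \<phi> t = \<Phi> (t - s) s (\<phi> s))"

definition singleton_family :: "(real \<Rightarrow> ('a \<Rightarrow> 'b) set) \<Rightarrow> ('a, 'b) Lp_family" where
  "singleton_family \<phi> = (\<lambda>t. {\<phi> t})"

end

theory Submission
  imports Defs
begin

text \<open>
  Invariance lets one choose preimages of a point of \<open>\<A> t\<close> at the times \<open>t - 1\<close>, \<open>t - 2\<close>, \<dots>; flowing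
  forward from them gives a complete trajectory inside \<open>\<A>\<close>, which inherits backwards boundedness and
  membership in \<open>\<D>\<close>. Conversely, a complete trajectory \<open>\<phi>\<close> in \<open>\<D>\<close> is its own pullback image, so \<open>\<phi> t\<close>
  lies in every weak neighbourhood of \<open>\<A> t\<close>; as the weak topology is \<open>T\<^sub>1\<close>, the complement of a point
  outside \<open>\<A> t\<close> is such a neighbourhood. That the dual of \<open>L\<^sup>p\<close> separates points is reduced to the
  Hahn-Banach theorem in the value space: a strongly measurable function that is not almost everywhere
  zero is close to a nonzero constant vector on a set of positive measure.
\<close>

section \<open>The Hahn-Banach theorem\<close>

text \<open>One-dimensional step of Hahn-Banach, with the partial functional given as its graph
  \<open>G\<close>. Any value \<open>r\<close> at \<open>z\<close> lying above all
  \<open>a - q (x - z)\<close> and below all \<open>q (y + z) - b\<close> keeps the extension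
  dominated; positive homogeneity reduces a general multiple of \<open>z\<close> to the multiples
  \<open>z\<close> and \<open>- z\<close>.\<close>

lemma sublinear_graph_extend:
  fixes q :: "'v::real_vector \<Rightarrow> real"
  assumes sub: "\<And>x y. q (x + y) \<le> q x + q y"
    and hom: "\<And>c x. 0 < c \<Longrightarrow> q (c *\<^sub>R x) = c * q x"
    and G: "subspace G" and le: "\<And>x a. (x, a) \<in> G \<Longrightarrow> a \<le> q x"
  obtains r where "\<And>x a. (x, a) \<in> span (insert (z, r) G) \<Longrightarrow> a \<le> q x"
proof -
  have gap: "a - q (x - z) \<le> q (y + z) - b" if "(x, a) \<in> G" "(y, b) \<in> G" for x a y b
  proof -
    have "a + b \<le> q ((x - z) + (y + z))"
      using le subspace_add[OF G that] by simp
    also have "\<dots> \<le> q (x - z) + q (y + z)" by (rule sub)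
    finally show ?thesis by simp
  qed
  have zero: "(0, 0) \<in> G" using subspace_0[OF G] by (simp add: zero_prod_def)
  \<comment> \<open>By \<open>gap\<close> every lower bound for the new value lies below every upper
    bound, so the supremum of \<open>L\<close> is an admissible choice of \<open>r\<close>.\<close>
  define L where "L = {a - q (x - z) | x a. (x, a) \<in> G}"
  have bdd: "bdd_above L"
    unfolding L_def bdd_above_def using gap[OF _ zero] by blast
  have ne: "L \<noteq> {}" using zero by (auto simp: L_def)
  have lower: "a - q (x - z) \<le> Sup L" if "(x, a) \<in> G" for x a
    using that by (intro cSup_upper[OF _ bdd]) (auto simp: L_def)
  have upper: "Sup L \<le> q (y + z) - b" if "(y, b) \<in> G" for y b
    using gap that by (intro cSup_least[OF ne]) (auto simp: L_def)
  show thesis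
  proof
    fix x a assume "(x, a) \<in> span (insert (z, Sup L) G)"
    then obtain k where "(x, a) - k *\<^sub>R (z, Sup L) \<in> span G"
      by (auto simp: span_insert)
    then have mem: "(x - k *\<^sub>R z, a - k * Sup L) \<in> G"
      by (simp add: span_eq_iff[THEN iffD2, OF G])
    consider "k = 0" | "0 < k" | "k < 0" by linarith
    then show "a \<le> q x"
    proof cases
      case 1 then show ?thesis using le[OF mem] by simp
    next
      case 2
      \<comment> \<open>Dividing by \<open>k\<close> makes the coefficient of \<open>z\<close> equal
        to 1, which is the situation of \<open>upper\<close>; for negative \<open>k\<close>,
        dividing by \<open>-k\<close> leads to \<open>lower\<close>.\<close>
      have "(inverse k *\<^sub>R (x - k *\<^sub>R z), inverse k * (a - k * Sup L)) \<in> G"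
        using subspace_scale[OF G mem, of "inverse k"] by simp
      from upper[OF this] have "k * Sup L \<le> k * (q (inverse k *\<^sub>R x) - inverse k * (a - k * Sup L))"
        using 2 by (simp add: scaleR_diff_right)
      also have "\<dots> = q x - (a - k * Sup L)"
        using 2 hom[of "inverse k" x] by (simp add: right_diff_distrib flip: mult.assoc)
      finally show ?thesis by simp
    next
      case 3
      have "(inverse (-k) *\<^sub>R (x - k *\<^sub>R z), inverse (-k) * (a - k * Sup L)) \<in> G"
        using subspace_scale[OF G mem, of "inverse (-k)"] by simp
      moreover have "inverse (-k) *\<^sub>R (x - k *\<^sub>R z) - z = inverse (-k) *\<^sub>R x"
        using 3 by (simp add: scaleR_diff_right)
      ultimately have "inverse (-k) * (a - k * Sup L) - q (inverse (-k) *\<^sub>R x) \<le> Sup L"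
        using lower by metis
      then have "(-k) * (inverse (-k) * (a - k * Sup L) - q (inverse (-k) *\<^sub>R x)) \<le> (-k) * Sup L"
        using 3 by (intro mult_left_mono) auto
      moreover have "(-k) * (inverse (-k) * (a - k * Sup L) - q (inverse (-k) *\<^sub>R x))
          = (a - k * Sup L) - q x"
        using 3 hom[of "inverse (-k)" x] by (simp add: field_simps)
      ultimately show ?thesis by simp
    qed
  qed
qed

text \<open>Partial functionals are represented by their graphs; a subspace of the product on which the second
  component is dominated by \<open>q\<close> is automatically single-valued.\<close>

theorem Hahn_Banach_graph:
  fixes q :: "'v::real_vector \<Rightarrow> real"
  assumes sub: "\<And>x y. q (x + y) \<le> q x + q y"
    and hom: "\<And>c x. 0 < c \<Longrightarrow> q (c *\<^sub>R x) = c * q x"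
    and G: "subspace G" and le: "\<And>x a. (x, a) \<in> G \<Longrightarrow> a \<le> q x"
  obtains f where "linear f" "\<And>x. f x \<le> q x" "\<And>x a. (x, a) \<in> G \<Longrightarrow> f x = a"
proof -
  define S where "S = {H. subspace H \<and> G \<subseteq> H \<and> (\<forall>x a. (x, a) \<in> H \<longrightarrow> a \<le> q x)}"
  have "\<exists>H\<in>S. \<forall>X\<in>S. H \<subseteq> X \<longrightarrow> X = H"
  proof (rule subset_Zorn_nonempty)
    show "S \<noteq> {}" using G le by (auto simp: S_def)
  next
    fix C assume ne: "C \<noteq> {}" and C: "subset.chain S C"
    then have CS: "\<And>X. X \<in> C \<Longrightarrow> X \<in> S" and lin: "\<And>X Y. X \<in> C \<Longrightarrow> Y \<in> C \<Longrightarrow> X \<subseteq> Y \<or> Y \<subseteq> X"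
      by (auto simp: subset_chain_def)
    have "subspace (\<Union>C)"
    proof (rule subspaceI)
      show "0 \<in> \<Union>C" using ne CS by (auto simp: S_def subspace_0)
      show "x + y \<in> \<Union>C" if "x \<in> \<Union>C" "y \<in> \<Union>C" for x y
      proof -
        from that obtain X Y where "X \<in> C" "Y \<in> C" "x \<in> X" "y \<in> Y" by blast
        with lin obtain Z where "Z \<in> C" "x \<in> Z" "y \<in> Z" by blast
        then show ?thesis using CS by (auto simp: S_def intro: subspace_add)
      qed
      show "c *\<^sub>R x \<in> \<Union>C" if "x \<in> \<Union>C" for c x
        using that CS by (auto simp: S_def intro: subspace_scale)
    qed
    then show "\<Union>C \<in> S" using ne CS by (fastforce simp: S_def)
  qed
  then obtain H where "H \<in> S" and max: "\<And>X. X \<in> S \<Longrightarrow> H \<subseteq> X \<Longrightarrow> X = H" by blast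
  then have H: "subspace H" and GH: "G \<subseteq> H" and Hle: "\<And>x a. (x, a) \<in> H \<Longrightarrow> a \<le> q x"
    by (auto simp: S_def)
  \<comment> \<open>If \<open>(x, a)\<close> and \<open>(x, b)\<close> lie in \<open>H\<close>, so
    does \<open>(0, a - b)\<close>, and domination gives \<open>a - b \<le> q 0 = 0\<close>. By
    symmetry \<open>H\<close> is single-valued.\<close>
  have "q 0 = 0" using hom[of 2 0] by simp
  have le0: "a \<le> b" if "(x, a) \<in> H" "(x, b) \<in> H" for x a b
    using Hle subspace_diff[OF H that] \<open>q 0 = 0\<close> by fastforce
  have uniq: "a = b" if "(x, a) \<in> H" "(x, b) \<in> H" for x a b
    using le0 that by (meson order_antisym)
  \<comment> \<open>A point outside the domain of \<open>H\<close> would allow a proper dominated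
    extension, against maximality.\<close>
  have total: "\<exists>a. (x, a) \<in> H" for x
  proof -
    obtain r where r: "\<And>y a. (y, a) \<in> span (insert (x, r) H) \<Longrightarrow> a \<le> q y"
      using sublinear_graph_extend[OF sub hom H Hle] by metis
    have sup: "insert (x, r) H \<subseteq> span (insert (x, r) H)" by (rule span_superset)
    with GH r have "span (insert (x, r) H) \<in> S" by (auto simp: S_def)
    with max sup have "span (insert (x, r) H) = H" by blast
    with sup show ?thesis by blast
  qed
  define f where "f x = (THE a. (x, a) \<in> H)" for x
  have f: "f x = a" if "(x, a) \<in> H" for x a
    unfolding f_def using that uniq by blast
  have fH: "(x, f x) \<in> H" for x
    using total[of x] f by blast
  show thesis
  proof
    show "linear f"
      using subspace_add[OF H fH fH] subspace_scale[OF H fH]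
      by (intro linearI f) auto
    show "f x \<le> q x" for x using Hle[OF fH] .
    show "f x = a" if "(x, a) \<in> G" for x a using f GH that by blast
  qed
qed

text \<open>Hahn-Banach with \<open>q = norm\<close>, starting from the line through
  \<open>(c, norm c)\<close>. Applying the one-sided bound to \<open>- x\<close> as well yields the
  bound on \<open>\<bar>f x\<bar>\<close>.\<close>

corollary norming_functional:
  fixes c :: "'b::real_normed_vector"
  obtains f :: "'b \<Rightarrow> real" where "bounded_linear f" "\<And>x. \<bar>f x\<bar> \<le> norm x" "f c = norm c"
proof -
  have le: "a \<le> norm x" if "(x, a) \<in> span {(c, norm c)}" for x a
  proof -
    from that obtain k where "x = k *\<^sub>R c" "a = k * norm c"
      by (auto simp: span_singleton)
    then show ?thesis by (simp add: mult_right_mono)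
  qed
  obtain f where lin: "linear f" and f: "\<And>x. f x \<le> norm x"
      and "\<And>x a. (x, a) \<in> span {(c, norm c)} \<Longrightarrow> f x = a"
    using Hahn_Banach_graph[of norm "span {(c, norm c)}"] le
    by (metis abs_of_pos norm_scaleR norm_triangle_ineq subspace_span)
  then have "f c = norm c" by (simp add: span_base)
  moreover have abs: "\<bar>f x\<bar> \<le> norm x" for x
    using f[of x] f[of "- x"] linear_neg[OF lin, of x] by (simp add: abs_le_iff)
  moreover have "bounded_linear f"
    using abs by (intro bounded_linear_intro[where K = 1]) 
      (auto simp: linear_add[OF lin] linear_scale[OF lin])
  ultimately show thesis using that by blast
qed

section \<open>The dual of the Lp space\<close>

lemma Lp_functions_borel_measurable:
  "y \<in> Lp_functions M p \<Longrightarrow> y \<in> borel_measurable M"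
  by (simp add: Lp_functions_def bochner_integrable_def strongly_measurable_imp_borel_measurable)

lemma Lp_functions_norm_integrable:
  assumes "prob_space M" "1 \<le> p" and y: "y \<in> Lp_functions M p"
  shows "integrable M (\<lambda>\<omega>. norm (y \<omega>))"
proof -
  interpret prob_space M by fact
  have le: "norm (y \<omega>) \<le> 1 + norm (y \<omega>) powr p" for \<omega>
    using powr_mono[OF \<open>1 \<le> p\<close>, of "norm (y \<omega>)"]
    by (cases "norm (y \<omega>) \<le> 1") (auto intro: add_increasing2)
  have "integrable M (\<lambda>\<omega>. 1 + norm (y \<omega>) powr p)"
    using y by (auto simp: Lp_functions_def)
  then show ?thesis
  proof (rule Bochner_Integration.integrable_bound)
    show "(\<lambda>\<omega>. norm (y \<omega>)) \<in> borel_measurable M"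
      by (rule measurable_compose[OF Lp_functions_borel_measurable[OF y] borel_measurable_norm])
    show "AE \<omega> in M. norm (norm (y \<omega>)) \<le> norm (1 + norm (y \<omega>) powr p)"
      using le by (simp add: abs_of_nonneg)
  qed
qed

text \<open>A crude substitute for Jensen's inequality, sufficient for continuity of functionals.
  After division by the Lp norm \<open>?C\<close>, the pointwise bound
  \<open>u \<le> 1 + u powr p\<close> integrates to 2 over a probability space.\<close>

lemma Lp_norm_bounds_integral_norm:
  assumes "prob_space M" "1 \<le> p" and y: "y \<in> Lp_functions M p"
  shows "(\<integral>\<omega>. norm (y \<omega>) \<partial>M) \<le> 2 * Lp_norm M p (Lp_class M p y)"
proof -
  interpret prob_space M by fact
  let ?I = "\<integral>\<omega>. norm (y \<omega>) powr p \<partial>M"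
  let ?C = "?I powr (1 / p)"
  have int: "integrable M (\<lambda>\<omega>. norm (y \<omega>) powr p)" using y by (simp add: Lp_functions_def)
  have inty: "integrable M (\<lambda>\<omega>. norm (y \<omega>))" by (rule Lp_functions_norm_integrable[OF assms])
  have "0 \<le> ?I" by simp
  show ?thesis
  proof (cases "?I = 0")
    case True
    then have "AE \<omega> in M. norm (y \<omega>) powr p = 0"
      using integral_nonneg_eq_0_iff_AE[OF int] by simp
    then have "(\<integral>\<omega>. norm (y \<omega>) \<partial>M) = (\<integral>\<omega>. 0 \<partial>M)"
      using inty by (intro integral_cong_AE) auto
    then show ?thesis by (simp add: Lp_norm_def)
  next
    case False
    then have C: "0 < ?C" "?C powr p = ?I" using \<open>0 \<le> ?I\<close> \<open>1 \<le> p\<close> by (auto simp: powr_powr)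
    have le: "norm (y \<omega>) \<le> ?C * (1 + norm (y \<omega>) powr p / ?I)" for \<omega>
    proof -
      have "norm (y \<omega>) / ?C \<le> 1 + (norm (y \<omega>) / ?C) powr p"
        using powr_mono[OF \<open>1 \<le> p\<close>, of "norm (y \<omega>) / ?C"]
        by (cases "norm (y \<omega>) / ?C \<le> 1") (auto intro: order_trans)
      then show ?thesis
        using C by (simp add: powr_divide pos_divide_le_eq mult.commute)
    qed
    have "(\<integral>\<omega>. norm (y \<omega>) \<partial>M) \<le> (\<integral>\<omega>. ?C * (1 + norm (y \<omega>) powr p / ?I) \<partial>M)"
      using le inty int by (intro integral_mono) auto
    also have "\<dots> = 2 * ?C"
      using int False by (simp add: prob_space)
    finally show ?thesis by (simp add: Lp_norm_class[OF y])
  qed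
qed

lemma Lp_cases:
  assumes "Y \<in> Lp M p"
  obtains y where "y \<in> Lp_functions M p" "Y = Lp_class M p y"
  using assms by (auto simp: Lp_def Lp_class_def elim: quotientE)

lemma Lp_class_eqI:
  assumes "y \<in> Lp_functions M p" "z \<in> Lp_functions M p" "AE \<omega> in M. y \<omega> = z \<omega>"
  shows "Lp_class M p y = Lp_class M p z"
  unfolding Lp_class_def
  using assms by (intro equiv_class_eq[OF equiv_Lp_rel]) (simp add: Lp_rel_def)

section \<open>Functionals given by integration over an event\<close>

text \<open>The functional sending \<open>y\<close> to the integral of \<open>f\<close> composed
  with \<open>y\<close> over \<open>E\<close>. It must act on classes, hence the chosen
  representative; \<open>Lp_pairing_class\<close> shows that the choice is immaterial.\<close>

definition Lp_pairing ::
  "'a measure \<Rightarrow> 'a set \<Rightarrow> ('b::banach \<Rightarrow> real) \<Rightarrow> ('a \<Rightarrow> 'b) set \<Rightarrow> real" where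
  "Lp_pairing M E f Y = (\<integral>\<omega>. indicator E \<omega> * f ((SOME y. y \<in> Y) \<omega>) \<partial>M)"

lemma measurable_bounded_linear_comp:
  assumes "bounded_linear (f :: 'b::banach \<Rightarrow> real)" "y \<in> borel_measurable M"
  shows "(\<lambda>\<omega>. f (y \<omega>)) \<in> borel_measurable M"
  using assms(1)
  by (intro measurable_compose[OF assms(2)] borel_measurable_continuous_onI
      linear_continuous_on)

lemma Lp_pairing_class:
  assumes "bounded_linear f" "E \<in> sets M" and y: "y \<in> Lp_functions M p"
  shows "Lp_pairing M E f (Lp_class M p y) = (\<integral>\<omega>. indicator E \<omega> * f (y \<omega>) \<partial>M)"
proof -
  have "y \<in> Lp_class M p y"
    using y by (simp add: Lp_class_def Lp_rel_def)
  then have "(SOME z. z \<in> Lp_class M p y) \<in> Lp_class M p y"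
    by (rule someI[where P = "\<lambda>z. z \<in> Lp_class M p y"])
  then obtain z where z: "z = (SOME z. z \<in> Lp_class M p y)" "z \<in> Lp_functions M p"
      and ae: "AE \<omega> in M. y \<omega> = z \<omega>"
    by (auto simp: Lp_class_def Lp_rel_def)
  note [measurable] = \<open>E \<in> sets M\<close>
    measurable_bounded_linear_comp[OF assms(1) Lp_functions_borel_measurable[OF y]]
    measurable_bounded_linear_comp[OF assms(1) Lp_functions_borel_measurable[OF z(2)]]
  have "(\<integral>\<omega>. indicator E \<omega> * f (z \<omega>) \<partial>M) = (\<integral>\<omega>. indicator E \<omega> * f (y \<omega>) \<partial>M)"
    using ae by (intro integral_cong_AE) auto
  then show ?thesis by (simp add: Lp_pairing_def flip: z(1))
qed

lemma Lp_pairing_integrable: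
  assumes "prob_space M" "1 \<le> p" "bounded_linear f" "\<And>x. \<bar>f x\<bar> \<le> norm x" "E \<in> sets M"
    and y: "y \<in> Lp_functions M p"
  shows "integrable M (\<lambda>\<omega>. indicator E \<omega> * f (y \<omega>))"
proof (rule Bochner_Integration.integrable_bound[OF Lp_functions_norm_integrable[OF assms(1,2) y]])
  note [measurable] = \<open>E \<in> sets M\<close>
    measurable_bounded_linear_comp[OF assms(3) Lp_functions_borel_measurable[OF y]]
  show "(\<lambda>\<omega>. indicator E \<omega> * f (y \<omega>)) \<in> borel_measurable M" by measurable
  show "AE \<omega> in M. norm (indicator E \<omega> * f (y \<omega>)) \<le> norm (norm (y \<omega>))"
    using assms(4) by (auto simp: indicator_def)
qed

lemma Lp_pairing_in_dual:
  fixes f :: "'b::banach \<Rightarrow> real"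
  assumes M: "prob_space M" "1 \<le> p" and f: "bounded_linear f" "\<And>x. \<bar>f x\<bar> \<le> norm x" and E: "E \<in> sets M"
  shows "Lp_pairing M E f \<in> Lp_dual M p"
proof -
  note lin = bounded_linear.linear[OF f(1)]
  note cls = Lp_pairing_class[OF f(1) E] and int = Lp_pairing_integrable[OF M f E]
  have add: "(\<lambda>\<omega>. y \<omega> + z \<omega>) \<in> Lp_functions M p"
    if "y \<in> Lp_functions M p" "z \<in> Lp_functions M p" for y z :: "'a \<Rightarrow> 'b"
    using Lp_functions_linear_combination[OF that, of 1 1] M(2) by simp
  have scale: "(\<lambda>\<omega>. c *\<^sub>R y \<omega>) \<in> Lp_functions M p" if "y \<in> Lp_functions M p" for c and y :: "'a \<Rightarrow> 'b"
    using Lp_functions_linear_combination[OF that that, of c 0] M(2) by simp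
  have bound: "\<bar>Lp_pairing M E f Y\<bar> \<le> 2 * Lp_norm M p Y" if "Y \<in> Lp M p" for Y
  proof -
    obtain y where y: "y \<in> Lp_functions M p" "Y = Lp_class M p y"
      using Lp_cases[OF \<open>Y \<in> Lp M p\<close>] by blast
    have "\<bar>Lp_pairing M E f Y\<bar> \<le> (\<integral>\<omega>. \<bar>indicator E \<omega> * f (y \<omega>)\<bar> \<partial>M)"
      unfolding y(2) cls[OF y(1)] by (rule integral_abs_bound)
    also have "\<dots> \<le> (\<integral>\<omega>. norm (y \<omega>) \<partial>M)"
      using f(2) int[OF y(1)] Lp_functions_norm_integrable[OF M y(1)]
      by (intro integral_mono) (auto simp: indicator_def)
    also have "\<dots> \<le> 2 * Lp_norm M p Y"
      unfolding y(2) by (rule Lp_norm_bounds_integral_norm[OF M y(1)])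
    finally show ?thesis .
  qed
  show ?thesis
    unfolding Lp_dual_def
  proof (intro CollectI conjI ballI allI)
    fix y z :: "'a \<Rightarrow> 'b" assume yz: "y \<in> Lp_functions M p" "z \<in> Lp_functions M p"
    show "Lp_pairing M E f (Lp_class M p (\<lambda>\<omega>. y \<omega> + z \<omega>))
        = Lp_pairing M E f (Lp_class M p y) + Lp_pairing M E f (Lp_class M p z)"
      using yz by (simp add: cls add linear_add[OF lin] distrib_left int)
  next
    fix c and y :: "'a \<Rightarrow> 'b" assume y: "y \<in> Lp_functions M p"
    show "Lp_pairing M E f (Lp_class M p (\<lambda>\<omega>. c *\<^sub>R y \<omega>)) = c * Lp_pairing M E f (Lp_class M p y)"
      using y by (simp add: cls scale linear_scale[OF lin] mult.left_commute)
  qed (use bound in blast)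
qed

section \<open>Separation of points by the dual\<close>

text \<open>The approximating simple functions take countably many values \<open>c\<close> in all,
  and the associated events cover the set where \<open>w\<close> is nonzero, so they cannot all be
  null. Such a \<open>c\<close> is nonzero automatically, since for \<open>c = 0\<close> the event
  is empty.\<close>

lemma strongly_measurable_near_constant:
  fixes w :: "'a \<Rightarrow> 'b::banach"
  assumes w: "strongly_measurable M w" and nz: "\<not> (AE \<omega> in M. w \<omega> = 0)"
  obtains c where "{\<omega> \<in> space M. norm (w \<omega> - c) < norm c / 2} \<in> sets M"
    "\<not> (AE \<omega> in M. \<omega> \<notin> {\<omega> \<in> space M. norm (w \<omega> - c) < norm c / 2})"
proof -
  obtain s where s: "\<And>i::nat. simple_function M (s i)"
    and lim: "\<And>\<omega>. \<omega> \<in> space M \<Longrightarrow> (\<lambda>i. s i \<omega>) \<longlonglongrightarrow> w \<omega>"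
    using w by (auto simp: strongly_measurable_def)
  define R where "R = (\<Union>i. s i ` space M)"
  have "countable R"
    unfolding R_def using s by (auto intro: countable_finite simp: simple_function_def)
  let ?E = "\<lambda>c. {\<omega> \<in> space M. norm (w \<omega> - c) < norm c / 2}"
  have sets: "?E c \<in> sets M" for c
  proof -
    have "(\<lambda>\<omega>. norm (w \<omega> - c)) \<in> borel_measurable M"
      by (intro measurable_compose[OF strongly_measurable_imp_borel_measurable[OF w]]
          borel_measurable_continuous_onI continuous_intros)
    then show ?thesis by measurable
  qed
  have cover: "\<exists>c\<in>R. \<omega> \<in> ?E c" if "\<omega> \<in> space M" "w \<omega> \<noteq> 0" for \<omega>
  proof -
    \<comment> \<open>With the factor 1/3, \<open>norm (s i \<omega>)\<close> exceeds two thirds of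
      \<open>norm (w \<omega>)\<close>, so the error is below half of
      \<open>norm (s i \<omega>)\<close>.\<close>
    have "eventually (\<lambda>i. dist (s i \<omega>) (w \<omega>) < norm (w \<omega>) / 3) sequentially"
      using that by (intro tendstoD[OF lim]) auto
    then obtain i where i: "norm (w \<omega> - s i \<omega>) < norm (w \<omega>) / 3"
      by (auto simp: eventually_sequentially dist_norm norm_minus_commute)
    moreover have "norm (w \<omega>) \<le> norm (w \<omega> - s i \<omega>) + norm (s i \<omega>)"
      using norm_triangle_ineq[of "w \<omega> - s i \<omega>" "s i \<omega>"] by simp
    ultimately have "\<omega> \<in> ?E (s i \<omega>)" using that by simp
    moreover have "s i \<omega> \<in> R" using that by (auto simp: R_def)
    ultimately show ?thesis by blast
  qed
  have "\<exists>c\<in>R. \<not> (AE \<omega> in M. \<omega> \<notin> ?E c)"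
  proof (rule ccontr)
    assume "\<not> ?thesis"
    then have "AE \<omega> in M. \<forall>c\<in>R. \<omega> \<notin> ?E c"
      using \<open>countable R\<close> by (simp add: AE_ball_countable)
    then have "AE \<omega> in M. w \<omega> = 0"
      using AE_space
    proof eventually_elim
      case (elim \<omega>)
      then show ?case using cover by blast
    qed
    with nz show False by simp
  qed
  with sets that show thesis by blast
qed

text \<open>The difference \<open>?w\<close> of representatives stays near some \<open>c\<close> on
  an event \<open>?E\<close> of positive measure. A functional norming \<open>c\<close> is positive
  on \<open>?w\<close> there, so integrating it over \<open>?E\<close> distinguishes the two
  classes.\<close>

proposition Lp_dual_separates_points:
  assumes M: "prob_space M" "1 \<le> p" and XY: "X \<in> Lp M p" "Y \<in> Lp M p" "X \<noteq> Y"
  obtains l where "l \<in> Lp_dual M p" "l X \<noteq> l Y"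
proof -
  obtain x y where x: "x \<in> Lp_functions M p" "X = Lp_class M p x"
    and y: "y \<in> Lp_functions M p" "Y = Lp_class M p y"
    using XY(1,2) by (auto elim!: Lp_cases)
  let ?w = "\<lambda>\<omega>. x \<omega> - y \<omega>"
  have w: "?w \<in> Lp_functions M p"
    using Lp_functions_linear_combination[OF x(1) y(1), of 1 "-1"] M(2) by simp
  have "\<not> (AE \<omega> in M. ?w \<omega> = 0)"
    using Lp_class_eqI[OF x(1) y(1)] x(2) y(2) XY(3) by auto
  moreover have "strongly_measurable M ?w"
    using w by (simp add: Lp_functions_def bochner_integrable_def)
  ultimately obtain c where c: "{\<omega> \<in> space M. norm (?w \<omega> - c) < norm c / 2} \<in> sets M"
    "\<not> (AE \<omega> in M. \<omega> \<notin> {\<omega> \<in> space M. norm (?w \<omega> - c) < norm c / 2})"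
    using strongly_measurable_near_constant by blast
  let ?E = "{\<omega> \<in> space M. norm (?w \<omega> - c) < norm c / 2}"
  note E = c(1) and pos = c(2)
  obtain f where f: "bounded_linear f" "\<And>x. \<bar>f x\<bar> \<le> norm x" "f c = norm c"
    using norming_functional by blast
  note lin = bounded_linear.linear[OF f(1)]
  note int = Lp_pairing_integrable[OF M f(1,2) E]
  have fw: "0 < f (?w \<omega>)" if "\<omega> \<in> ?E" for \<omega>
  proof -
    have "f (?w \<omega>) - f c = f (?w \<omega> - c)"
      by (rule linear_diff[OF lin, symmetric])
    moreover have "\<bar>f (?w \<omega> - c)\<bar> < norm c / 2"
      using f(2)[of "?w \<omega> - c"] that by simp
    moreover have "0 \<le> norm c" by simp
    ultimately show ?thesis using f(3) by linarith
  qed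
  have "(\<integral>\<omega>. indicator ?E \<omega> * f (?w \<omega>) \<partial>M) \<noteq> 0"
  proof
    assume "(\<integral>\<omega>. indicator ?E \<omega> * f (?w \<omega>) \<partial>M) = 0"
    then have "AE \<omega> in M. indicator ?E \<omega> * f (?w \<omega>) = 0"
      using fw by (subst (asm) integral_nonneg_eq_0_iff_AE[OF int[OF w]])
        (auto simp: indicator_def less_imp_le)
    then have "AE \<omega> in M. \<omega> \<notin> ?E"
    proof eventually_elim
      case (elim \<omega>)
      show ?case
      proof
        assume "\<omega> \<in> ?E"
        with elim fw[OF this] show False by (simp only: indicator_simps)
      qed
    qed
    with pos show False ..
  qed
  moreover have "(\<integral>\<omega>. indicator ?E \<omega> * f (?w \<omega>) \<partial>M)
      = (\<integral>\<omega>. indicator ?E \<omega> * f (x \<omega>) \<partial>M) - (\<integral>\<omega>. indicator ?E \<omega> * f (y \<omega>) \<partial>M)"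
    using int[OF x(1)] int[OF y(1)]
    by (subst Bochner_Integration.integral_diff[symmetric])
      (auto simp: linear_diff[OF lin] right_diff_distrib)
  ultimately have "Lp_pairing M ?E f X \<noteq> Lp_pairing M ?E f Y"
    using Lp_pairing_class[OF f(1) E x(1)] Lp_pairing_class[OF f(1) E y(1)] x(2) y(2) by simp
  with Lp_pairing_in_dual[OF M f(1,2) E] show thesis by (rule that)
qed

text \<open>The weakly open sets where some \<open>l\<close> in the dual differs from
  \<open>l Y\<close> all avoid \<open>Y\<close>; since the dual separates points, their union
  contains \<open>K\<close>.\<close>

lemma weak_nbhd_delete_point:
  assumes M: "prob_space M" "1 \<le> p" and K: "K \<subseteq> Lp M p" and Y: "Y \<in> Lp M p" "Y \<notin> K"
  shows "weak_nbhd M p K (Lp M p - {Y})"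
proof -
  define \<U> where "\<U> = {{Z \<in> Lp M p. l Z \<in> - {l Y}} | l. l \<in> Lp_dual M p}"
  have "openin (weak_topology M p) U" if "U \<in> \<U>" for U
    using that unfolding weak_topology_def \<U>_def
    by (intro topology_generated_by_Basis) blast
  then have "openin (weak_topology M p) (\<Union>\<U>)" by blast
  moreover have "K \<subseteq> \<Union>\<U>"
  proof
    fix X assume "X \<in> K"
    with K Y have "X \<in> Lp M p" "X \<noteq> Y" by auto
    then obtain l where "l \<in> Lp_dual M p" "l X \<noteq> l Y"
      using Lp_dual_separates_points[OF M _ Y(1)] by blast
    with \<open>X \<in> Lp M p\<close> show "X \<in> \<Union>\<U>" by (auto simp: \<U>_def)
  qed
  moreover have "\<Union>\<U> \<subseteq> Lp M p - {Y}" by (auto simp: \<U>_def)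
  ultimately show ?thesis by (auto simp: weak_nbhd_def)
qed

section \<open>Complete trajectories\<close>

lemma invariant_family_trajectory:
  assumes \<Phi>: "mean_RDS M p \<Phi>" and A: "\<And>s. A s \<subseteq> Lp M p" and inv: "invariant_family \<Phi> A"
    and Y: "Y \<in> A t"
  obtains \<phi> where "complete_trajectory M p \<Phi> \<phi>" "\<phi> t = Y" "\<And>s. \<phi> s \<in> A s"
proof -
  have id: "\<Phi> 0 \<tau> Z = Z" if "Z \<in> Lp M p" for \<tau> Z
    using \<Phi> that by (simp add: mean_RDS_def)
  have comp: "\<Phi> (r + s) \<tau> Z = \<Phi> r (s + \<tau>) (\<Phi> s \<tau> Z)" if "0 \<le> r" "0 \<le> s" "Z \<in> Lp M p" for r s \<tau> Z
    using \<Phi> that by (simp add: mean_RDS_def)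
  have image: "A u = \<Phi> (u - s) s ` A s" if "s \<le> u" for s u
    using inv[unfolded invariant_family_def, rule_format, of "u - s" u] that by simp
  have "\<exists>Z'. Z' \<in> A (t - real (Suc n)) \<and> \<Phi> 1 (t - real (Suc n)) Z' = Z"
    if "Z \<in> A (t - real n)" for n Z
    using that image[of "t - real (Suc n)" "t - real n"] by auto
  \<comment> \<open>Dependent choice of a backward orbit in unit time steps; the clause for
    \<open>n = 0\<close> pins its starting point to \<open>Y\<close>.\<close>
  then obtain x where "\<forall>n. (x n \<in> A (t - real n) \<and> (n = 0 \<longrightarrow> x n = Y)) \<and>
      \<Phi> 1 (t - real (Suc n)) (x (Suc n)) = x n"
    using dependent_nat_choice[of "\<lambda>n Z. Z \<in> A (t - real n) \<and> (n = 0 \<longrightarrow> Z = Y)"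
        "\<lambda>n Z Z'. \<Phi> 1 (t - real (Suc n)) Z' = Z"] Y by auto
  then have x: "\<And>n. x n \<in> A (t - real n)" "x 0 = Y"
      "\<And>n. \<Phi> 1 (t - real (Suc n)) (x (Suc n)) = x n"
    by auto
  \<comment> \<open>The forward orbit started from \<open>x n\<close> at time \<open>t - n\<close>,
    meaningful for \<open>s \<ge> t - real n\<close>. By the cocycle property, starting further back
    does not change it.\<close>
  define \<psi> where "\<psi> n s = \<Phi> (s - (t - real n)) (t - real n) (x n)" for n s
  have step: "\<psi> (Suc n) s = \<psi> n s" if "t - real n \<le> s" for n s
    using comp[of "s - (t - real n)" 1 "x (Suc n)" "t - real (Suc n)"] that x(1)[of "Suc n"] A x(3)[of n]
    by (auto simp: \<psi>_def algebra_simps)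
  have \<psi>_eq: "\<psi> m s = \<psi> n s" if "n \<le> m" "t - real n \<le> s" for m n s
    using that by (induction m rule: dec_induct) (auto simp: step)
  \<comment> \<open>The first index whose starting time is at most \<open>s\<close>. Truncation by
    \<open>nat\<close> gives 0 for all \<open>s \<ge> t\<close>, so the trajectory at time
    \<open>t\<close> is \<open>\<Phi> 0 t Y = Y\<close>.\<close>
  define N where "N s = nat \<lceil>t - s\<rceil>" for s
  have N: "t - real (N s) \<le> s" for s
    unfolding N_def using of_nat_ceiling[of "t - s"] by linarith
  have \<psi>_N: "\<psi> (N s) u = \<psi> (N u) u" if "s \<le> u" for s u
  proof (rule \<psi>_eq[OF _ N])
    show "N u \<le> N s" unfolding N_def using that by (intro nat_mono ceiling_mono) simp
  qed
  have mem: "\<psi> (N s) s \<in> A s" for s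
    unfolding \<psi>_def using image[OF N, of s] x(1) by blast
  show thesis
  proof
    show "complete_trajectory M p \<Phi> (\<lambda>s. \<psi> (N s) s)"
      unfolding complete_trajectory_def
    proof (intro conjI allI impI)
      show "\<psi> (N s) s \<in> Lp M p" for s using mem A by blast
      fix s u :: real assume "s < u"
      define \<tau> where "\<tau> = t - real (N s)"
      \<comment> \<open>Both times are computed from the earlier starting time
        \<open>\<tau>\<close>, where the cocycle property applies directly; \<open>\<psi>_N\<close>
        then replaces \<open>N s\<close> by \<open>N u\<close>.\<close>
      have "x (N s) \<in> Lp M p" using x(1) A by blast
      then have "\<psi> (N s) u = \<Phi> (u - s) s (\<psi> (N s) s)"
        using comp[of "u - s" "s - \<tau>" "x (N s)" \<tau>] \<open>s < u\<close> N[of s]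
        by (simp add: \<psi>_def flip: \<tau>_def)
      with \<psi>_N[of s u] \<open>s < u\<close> show "\<psi> (N u) u = \<Phi> (u - s) s (\<psi> (N s) s)" by simp
    qed
    show "\<psi> (N t) t = Y"
      using Y x(2) A[of t] id[of Y t] by (auto simp: N_def \<psi>_def)
    show "\<psi> (N s) s \<in> A s" for s by (rule mem)
  qed
qed

text \<open>A trajectory is its own pullback image: \<open>\<phi> t\<close> is the image of
  \<open>\<phi> (t - r)\<close> for every \<open>r > 0\<close>. Were it outside \<open>K t\<close>,
  attraction to the neighborhood with \<open>\<phi> t\<close> deleted would be contradicted.\<close>

lemma trajectory_in_weakly_attracting:
  assumes M: "prob_space M" "1 \<le> p" and K: "K t \<subseteq> Lp M p"
    and attr: "pullback_weakly_attracting M p \<D> \<Phi> K"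
    and \<phi>: "singleton_family \<phi> \<in> \<D>" "complete_trajectory M p \<Phi> \<phi>"
  shows "\<phi> t \<in> K t"
proof (rule ccontr)
  assume "\<phi> t \<notin> K t"
  moreover have "\<phi> t \<in> Lp M p" using \<phi>(2) by (simp add: complete_trajectory_def)
  ultimately have "weak_nbhd M p (K t) (Lp M p - {\<phi> t})"
    using weak_nbhd_delete_point[OF M K] by blast
  with attr \<phi>(1) obtain T where "T > 0"
      "\<forall>r\<ge>T. \<Phi> r (t - r) ` singleton_family \<phi> (t - r) \<subseteq> Lp M p - {\<phi> t}"
    unfolding pullback_weakly_attracting_def by blast
  then have "\<Phi> T (t - T) (\<phi> (t - T)) \<noteq> \<phi> t"
    by (auto simp: singleton_family_def)
  \<comment> \<open>Positivity of \<open>T\<close> matters, as the trajectory equation relates only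
    distinct times.\<close>
  moreover have "\<phi> t = \<Phi> (t - (t - T)) (t - T) (\<phi> (t - T))"
    using \<phi>(2) \<open>T > 0\<close> unfolding complete_trajectory_def
    by (metis diff_less_eq less_add_same_cancel1)
  ultimately show False by simp
qed

section \<open>Description of the attractor by trajectories\<close>

lemma Lp_bounded_subset: "Lp_bounded M p B \<Longrightarrow> C \<subseteq> B \<Longrightarrow> Lp_bounded M p C"
  by (auto simp: Lp_bounded_def)

lemma backwards_bounded_singleton_family:
  assumes "backwards_bounded M p A" and \<phi>: "\<And>s. \<phi> s \<in> A s"
  shows "backwards_bounded M p (singleton_family \<phi>)"
proof -
  obtain t0 where A: "\<And>s. Lp_bounded M p (A s)" "Lp_bounded M p (\<Union>s\<in>{..t0}. A s)"
    using assms(1) by (auto simp: backwards_bounded_def bounded_family_def)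
  have "Lp_bounded M p {\<phi> s}" for s
    using \<phi> by (intro Lp_bounded_subset[OF A(1)[of s]]) auto
  moreover have "Lp_bounded M p (\<Union>s\<in>{..t0}. {\<phi> s})"
    using \<phi> by (intro Lp_bounded_subset[OF A(2)]) auto
  ultimately show ?thesis
    unfolding backwards_bounded_def bounded_family_def singleton_family_def by blast
qed

theorem lemma7:
  fixes M :: "'a measure" and p :: real
    and \<D> :: "('a, 'b::banach) Lp_family set"
    and \<Phi> :: "('a, 'b) Lp_process"
    and \<A> :: "('a, 'b) Lp_family"
  assumes "prob_space M" and "1 < p"
    and "\<forall>D\<in>\<D>. bounded_family M p D"
    and "inclusion_closed M p \<D>"
    and "mean_RDS M p \<Phi>"
    and "weak_pullback_mean_random_attractor M p \<D> \<Phi> \<A>"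
    and "invariant_family \<Phi> \<A>"
    and "backwards_bounded M p \<A>"
  shows "(\<forall>t. \<A> t = {\<phi> t | \<phi>. singleton_family \<phi> \<in> \<D> \<and> complete_trajectory M p \<Phi> \<phi> \<and>
                               backwards_bounded M p (singleton_family \<phi>)}) \<and>
         ((\<forall>D. backwards_bounded M p D \<longrightarrow> D \<in> \<D>) \<longrightarrow>
          (\<forall>t. \<A> t = {\<phi> t | \<phi>. complete_trajectory M p \<Phi> \<phi> \<and>
                                backwards_bounded M p (singleton_family \<phi>)}))"
proof -
  have A: "\<A> s \<subseteq> Lp M p" for s
    using assms(8) by (auto simp: backwards_bounded_def bounded_family_def Lp_bounded_def)
  have attr: "\<A> \<in> \<D>" "pullback_weakly_attracting M p \<D> \<Phi> \<A>"
    using assms(6) by (auto simp: weak_pullback_mean_random_attractor_def)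
  have eq: "\<A> t = {\<phi> t | \<phi>. singleton_family \<phi> \<in> \<D> \<and> complete_trajectory M p \<Phi> \<phi> \<and>
                             backwards_bounded M p (singleton_family \<phi>)}" (is "_ = ?R") for t
  proof
    show "\<A> t \<subseteq> ?R"
    proof
      fix Y assume "Y \<in> \<A> t"
      then obtain \<phi> where \<phi>: "complete_trajectory M p \<Phi> \<phi>" "\<phi> t = Y" "\<And>s. \<phi> s \<in> \<A> s"
        using invariant_family_trajectory[OF assms(5) A assms(7)] by blast
      have bb: "backwards_bounded M p (singleton_family \<phi>)"
        by (rule backwards_bounded_singleton_family[OF assms(8) \<phi>(3)])
      then have "bounded_family M p (singleton_family \<phi>)" by (simp add: backwards_bounded_def)
      \<comment> \<open>The singletons sit inside the attractor, so inclusion-closedness puts the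
        trajectory into \<open>\<D>\<close>.\<close>
      moreover have "\<forall>s. singleton_family \<phi> s \<subseteq> \<A> s" using \<phi>(3) by (simp add: singleton_family_def)
      ultimately have "singleton_family \<phi> \<in> \<D>"
        using assms(4) attr(1) unfolding inclusion_closed_def by blast
      with bb \<phi>(1,2) show "Y \<in> ?R" by blast
    qed
    show "?R \<subseteq> \<A> t"
      using trajectory_in_weakly_attracting[where t = t, OF assms(1) _ A attr(2)] \<open>1 < p\<close> by auto
  qed
  show ?thesis
  proof (intro conjI allI impI)
    show "\<A> t = {\<phi> t | \<phi>. singleton_family \<phi> \<in> \<D> \<and> complete_trajectory M p \<Phi> \<phi> \<and>
                           backwards_bounded M p (singleton_family \<phi>)}" for t by (rule eq)
  next
    fix t assume "\<forall>D. backwards_bounded M p D \<longrightarrow> D \<in> \<D>"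
    \<comment> \<open>Under the extra hypothesis, membership in \<open>\<D>\<close> follows from
      backwards boundedness, so both descriptions define the same set.\<close>
    then have "singleton_family \<phi> \<in> \<D> \<and> complete_trajectory M p \<Phi> \<phi> \<and>
          backwards_bounded M p (singleton_family \<phi>) \<longleftrightarrow>
        complete_trajectory M p \<Phi> \<phi> \<and> backwards_bounded M p (singleton_family \<phi>)" for \<phi>
      by blast
    with eq[of t] show "\<A> t = {\<phi> t | \<phi>. complete_trajectory M p \<Phi> \<phi> \<and>
                                       backwards_bounded M p (singleton_family \<phi>)}"
      by (simp only:)
  qed
qed

end
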